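(* Let $d\in(0,1)\cup(1,\infty)$ and, for $y>0$, define $$H_d(y)=\psi(y+d)-\psi(y)-\frac{d}{y},\qquad H_d^\sharp(y)=\operatorname{sign}(1-d)\,H_d(y).$$ Then $H_d^\sharp(y)>0$ for all $y>0$, and, for real $a$, the function $y\mapsto y^aH_d^\sharp(y)$ is strictly completely monotone on $(0,\infty)$ exactly when $a\le 1$.
   Context: $\psi=\Gamma'/\Gamma$ is the digamma function. A function $f\in C^\infty(0,\infty)$ is strictly completely monotone if $(-1)^n f^{(n)}(y)>0$ for all integers $n\ge 0$ and all $y>0$. *)

theory Defs
  imports "HOL-Analysis.Analysis"
begin

text \<open>
  The first clause is membership in $C^\infty(0,\infty)$: as all iterated derivatives are
  differentiable on the open half-line, they are all continuous there. Values of \<open>f\<close> outside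
  \<open>(0, \<infinity>)\<close> play no role, because \<open>(0, \<infinity>)\<close> is open and \<open>deriv\<close> is local.
\<close>
definition strictly_completely_monotone :: "(real \<Rightarrow> real) \<Rightarrow> bool" where
  "strictly_completely_monotone f \<longleftrightarrow>
     (\<forall>n. \<forall>y>0. (deriv ^^ n) f differentiable at y) \<and>
     (\<forall>n. \<forall>y>0. (-1) ^ n * (deriv ^^ n) f y > 0)"

definition H :: "real \<Rightarrow> real \<Rightarrow> real" where
  "H d y = Digamma (y + d) - Digamma y - d / y"

definition H_sharp :: "real \<Rightarrow> real \<Rightarrow> real" where
  "H_sharp d y = sgn (1 - d) * H d y"

end

theory Submission
  imports Defs
begin

text \<open>
  Everything rests on \<open>G(y) = y H\<^sub>d(y) = y (\<psi>(y + d) - \<psi>(y)) - d\<close> and on the fact that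
  \<open>sgn (1 - d) G\<close> is strictly completely monotone. Given this, \<open>y\<^sup>a H_sharp\<close> is, for \<open>a \<le> 1\<close>, the
  product of \<open>sgn (1 - d) G\<close> with the function \<open>y\<^sup>-\<^sup>b\<close>, \<open>b = 1 - a \<ge> 0\<close>, whose derivatives
  alternate weakly in sign, and Leibniz' rule applies. For \<open>a > 1\<close> the function \<open>y\<^sup>a H_sharp\<close> tends
  to \<open>0\<close> at \<open>0\<close>, because \<open>G\<close> tends to \<open>1 - d\<close> there; a positive and strictly decreasing function
  cannot do this.

  For the monotonicity of \<open>G\<close> one could use the Laplace representation
  \<open>G(y) = \<integral> exp (- y t) k'(t) dt\<close> over \<open>t > 0\<close>, where
  \<open>k(t) = (1 - exp (- d t)) / (1 - exp (- t))\<close>. The proof below replaces integrals by finite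
  differences. The recurrence \<open>\<psi>(y + 1) = \<psi>(y) + 1 / y\<close> makes the second difference
  \<open>G(y) - 2 G(y + 1) + G(y + 2)\<close> rational: it equals
  \<open>d / (y + d) - 1 / (y + 1) + (1 - d) / (y + 1 + d)\<close>. Up to the factor \<open>(-1)\<^sup>n n!\<close>, its \<open>n\<close>-th
  derivative has the same shape with the exponent \<open>n + 1\<close> in the denominators. Since
  \<open>y + 1 = d (y + d) + (1 - d) (y + 1 + d)\<close>, strict convexity of \<open>x\<^sup>-\<^sup>N\<close> gives it the sign of
  \<open>1 - d\<close> (\<open>second_difference_sign\<close>). \<open>G\<close>, its first difference and all their derivatives vanish at
  infinity (\<open>G_tendsto_0\<close>, \<open>G_difference_tendsto_0\<close>), and a function that vanishes at infinity
  and decreases under every unit step is positive; using this twice passes the sign from the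
  second difference to \<open>G\<close>.
\<close>

section \<open>Complete monotonicity from explicit derivatives\<close>

text \<open>
  Carrying the sign \<open>(-1)\<^sup>n\<close> inside the \<open>n\<close>-th member turns complete monotonicity into plain
  positivity of all members, and Leibniz' rule then has nonnegative terms only.
\<close>
definition alternating_derivatives :: "(nat \<Rightarrow> real \<Rightarrow> real) \<Rightarrow> (real \<Rightarrow> real) \<Rightarrow> bool" where
  "alternating_derivatives F f \<longleftrightarrow>
     (\<forall>y>0. F 0 y = f y) \<and>
     (\<forall>n. \<forall>y>0. (F n has_real_derivative - F (Suc n) y) (at y))"

lemma alternating_derivatives_eq_deriv:
  assumes F: "alternating_derivatives F f" and "y > 0"
  shows "(deriv ^^ n) f y = (-1) ^ n * F n y"
    and "((deriv ^^ n) f has_real_derivative (-1) ^ Suc n * F (Suc n) y) (at y)"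
proof -
  have D: "((deriv ^^ n) f has_real_derivative (-1) ^ Suc n * F (Suc n) y) (at y)"
    if "y > 0" and E: "\<And>x. x > 0 \<Longrightarrow> (deriv ^^ n) f x = (-1) ^ n * F n x" for n y
  proof (rule has_field_derivative_transform_within_open[where S = "{0<..}"])
    have "(F n has_real_derivative - F (Suc n) y) (at y)"
      using F that(1) by (simp add: alternating_derivatives_def)
    from DERIV_cmult[OF this, of "(-1) ^ n"]
    show "((\<lambda>x. (-1) ^ n * F n x) has_real_derivative (-1) ^ Suc n * F (Suc n) y) (at y)"
      by simp
  qed (use that in auto)
  have E: "(deriv ^^ n) f y = (-1) ^ n * F n y" if "y > 0" for n y
    using that
  proof (induction n arbitrary: y)
    case 0
    then show ?case using F by (simp add: alternating_derivatives_def)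
  next
    case (Suc n)
    from D[OF Suc.prems Suc.IH] show ?case by (simp add: DERIV_imp_deriv)
  qed
  show "(deriv ^^ n) f y = (-1) ^ n * F n y" using E \<open>y > 0\<close> .
  show "((deriv ^^ n) f has_real_derivative (-1) ^ Suc n * F (Suc n) y) (at y)"
    using D[OF \<open>y > 0\<close> E] .
qed

lemma strictly_completely_monotone_if_alternating:
  assumes F: "alternating_derivatives F f" and pos: "\<And>n y. y > 0 \<Longrightarrow> F n y > 0"
  shows "strictly_completely_monotone f"
  unfolding strictly_completely_monotone_def
proof (intro conjI allI impI)
  fix n and y :: real
  assume "y > 0"
  show "(deriv ^^ n) f differentiable at y"
    using alternating_derivatives_eq_deriv(2)[OF F \<open>y > 0\<close>] real_differentiable_def by blast
  show "(-1) ^ n * (deriv ^^ n) f y > 0"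
    using alternating_derivatives_eq_deriv(1)[OF F \<open>y > 0\<close>, of n] pos[OF \<open>y > 0\<close>, of n]
    by (simp flip: mult.assoc power_mult_distrib)
qed

lemma sum_choose_Suc:
  fixes a b :: "nat \<Rightarrow> 'a :: comm_semiring_1"
  shows "(\<Sum>k\<le>n. of_nat (n choose k) * (a (Suc k) * b (n - k) + a k * b (Suc (n - k)))) =
         (\<Sum>k\<le>Suc n. of_nat (Suc n choose k) * (a k * b (Suc n - k)))"
proof -
  have "(\<Sum>k\<le>Suc n. of_nat (Suc n choose k) * (a k * b (Suc n - k))) =
        a 0 * b (Suc n) + (\<Sum>k\<le>n. of_nat (n choose Suc k) * (a (Suc k) * b (n - k)))
        + (\<Sum>k\<le>n. of_nat (n choose k) * (a (Suc k) * b (n - k)))"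
    by (subst sum.atMost_Suc_shift) (simp add: algebra_simps sum.distrib)
  also have "a 0 * b (Suc n) + (\<Sum>k\<le>n. of_nat (n choose Suc k) * (a (Suc k) * b (n - k))) =
        (\<Sum>k\<le>Suc n. of_nat (n choose k) * (a k * b (Suc n - k)))"
    by (subst sum.atMost_Suc_shift) simp
  also have "\<dots> = (\<Sum>k\<le>n. of_nat (n choose k) * (a k * b (Suc (n - k))))"
    by (simp add: Suc_diff_le binomial_eq_0)
  finally show ?thesis
    by (simp add: algebra_simps sum.distrib)
qed

lemma alternating_derivatives_mult:
  assumes F: "alternating_derivatives F f" and G: "alternating_derivatives G g"
  shows "alternating_derivatives
           (\<lambda>n y. \<Sum>k\<le>n. of_nat (n choose k) * (F k y * G (n - k) y)) (\<lambda>y. f y * g y)"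
  unfolding alternating_derivatives_def
proof (intro conjI allI impI)
  fix y :: real
  assume "y > 0"
  then show "(\<Sum>k\<le>0. of_nat (0 choose k) * (F k y * G (0 - k) y)) = f y * g y"
    using F G by (simp add: alternating_derivatives_def)
next
  fix n and y :: real
  assume y: "y > 0"
  have dF: "(F k has_real_derivative - F (Suc k) y) (at y)" for k
    using F y by (simp add: alternating_derivatives_def)
  have dG: "(G k has_real_derivative - G (Suc k) y) (at y)" for k
    using G y by (simp add: alternating_derivatives_def)
  have "((\<lambda>y. \<Sum>k\<le>n. of_nat (n choose k) * (F k y * G (n - k) y)) has_real_derivative
      (\<Sum>k\<le>n. of_nat (n choose k) * (- F (Suc k) y * G (n - k) y + - G (Suc (n - k)) y * F k y)))
      (at y)"
    by (intro DERIV_sum DERIV_cmult DERIV_mult dF dG)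
  also have "(\<Sum>k\<le>n. of_nat (n choose k) * (- F (Suc k) y * G (n - k) y + - G (Suc (n - k)) y * F k y))
      = - (\<Sum>k\<le>n. of_nat (n choose k) * (F (Suc k) y * G (n - k) y + F k y * G (Suc (n - k)) y))"
    unfolding sum_negf[symmetric] by (intro sum.cong refl) (simp add: algebra_simps)
  also have "\<dots> = - (\<Sum>k\<le>Suc n. of_nat (Suc n choose k) * (F k y * G (Suc n - k) y))"
    by (simp only: sum_choose_Suc[where a = "\<lambda>k. F k y" and b = "\<lambda>k. G k y"])
  finally show "((\<lambda>y. \<Sum>k\<le>n. of_nat (n choose k) * (F k y * G (n - k) y)) has_real_derivative
      - (\<Sum>k\<le>Suc n. of_nat (Suc n choose k) * (F k y * G (Suc n - k) y))) (at y)" .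
qed

text \<open>
  One factor may be weakly alternating. Hence the constant function \<open>1 = y\<^sup>0\<close> is an admissible
  factor, and the exponent \<open>a = 1\<close> is not a special case.
\<close>
lemma strictly_completely_monotone_mult:
  assumes F: "alternating_derivatives F f" and G: "alternating_derivatives G g"
    and F0: "\<And>y. y > 0 \<Longrightarrow> F 0 y > 0" and F_nonneg: "\<And>n y. y > 0 \<Longrightarrow> F n y \<ge> 0"
    and G_pos: "\<And>n y. y > 0 \<Longrightarrow> G n y > 0"
    and h: "\<And>y. y > 0 \<Longrightarrow> h y = f y * g y"
  shows "strictly_completely_monotone h"
proof (rule strictly_completely_monotone_if_alternating)
  show "alternating_derivatives (\<lambda>n y. \<Sum>k\<le>n. of_nat (n choose k) * (F k y * G (n - k) y)) h"
    using alternating_derivatives_mult[OF F G] h by (simp add: alternating_derivatives_def)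
next
  fix n and y :: real
  assume y: "y > 0"
  show "(\<Sum>k\<le>n. of_nat (n choose k) * (F k y * G (n - k) y)) > 0"
  proof (rule sum_pos2[where i = 0])
    show "0 < real (n choose 0) * (F 0 y * G (n - 0) y)"
      using F0[OF y] G_pos[OF y] by simp
    show "0 \<le> real (n choose k) * (F k y * G (n - k) y)" for k
      using F_nonneg[OF y, of k] G_pos[OF y, of "n - k"] by simp
  qed auto
qed

lemma alternating_derivatives_powr:
  fixes b :: real
  shows "alternating_derivatives (\<lambda>n y. pochhammer b n * y powr (- b - n)) (\<lambda>y. y powr (- b))"
  unfolding alternating_derivatives_def
proof (intro conjI allI impI)
  fix n and y :: real
  assume "y > 0"
  then show "((\<lambda>y. pochhammer b n * y powr (- b - n)) has_real_derivative
      - (pochhammer b (Suc n) * y powr (- b - Suc n))) (at y)"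
    by (auto intro!: derivative_eq_intros simp: pochhammer_Suc algebra_simps)
qed simp

section \<open>Strict convexity of negative powers\<close>

lemma Bernoulli_inequality_strict:
  fixes w :: real
  assumes "w > 0" "w \<noteq> 1" "k \<ge> 1"
  shows "1 + real (Suc k) * (w - 1) < w ^ Suc k"
proof -
  have "1 + real (Suc k) * (w - 1) < 1 + real (Suc k) * (w - 1) + real k * (w - 1)\<^sup>2"
    using assms by simp
  also have "\<dots> = w * (1 + real k * (w - 1))"
    by (simp add: algebra_simps power2_eq_square)
  also have "\<dots> \<le> w * w ^ k"
    using Bernoulli_inequality[of "w - 1" k] assms by (intro mult_left_mono) auto
  finally show ?thesis by simp
qed

text \<open>
  The graph of \<open>x\<^sup>-\<^sup>N\<close> lies above its tangent at \<open>m\<close>: after clearing denominators this is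
  Bernoulli's inequality for the quotient \<open>m / x\<close>.
\<close>
lemma inverse_power_gt_tangent:
  fixes x m :: real
  assumes "x > 0" "m > 0" "x \<noteq> m" "N \<ge> 1"
  shows "1 / m ^ N - real N * (x - m) / m ^ Suc N < 1 / x ^ N"
proof -
  define w where "w = m / x"
  have w: "w > 0" "w \<noteq> 1" and x: "x = m / w"
    using assms by (auto simp: w_def)
  have "1 + real (Suc N) * (w - 1) < w ^ Suc N"
    using w assms by (intro Bernoulli_inequality_strict) auto
  then have "(1 + real N - real N / w) * w < w ^ N * w"
    using w by (simp add: algebra_simps)
  then have "1 + real N - real N / w < w ^ N"
    using w by simp
  then have "(1 + real N - real N / w) / m ^ N < w ^ N / m ^ N"
    using assms by (intro divide_strict_right_mono) auto
  moreover have "w ^ N / m ^ N = 1 / x ^ N"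
    using assms by (simp add: w_def power_divide)
  moreover have "(1 + real N - real N / w) / m ^ N = 1 / m ^ N - real N * (x - m) / m ^ Suc N"
    unfolding x using assms w by (simp add: field_simps)
  ultimately show ?thesis by simp
qed

lemma inverse_power_strict_Jensen:
  fixes a b \<alpha> \<beta> :: real
  assumes "a > 0" "b > 0" "a \<noteq> b" "\<alpha> > 0" "\<beta> > 0" "\<alpha> + \<beta> = 1" "N \<ge> 1"
  shows "1 / (\<alpha> * a + \<beta> * b) ^ N < \<alpha> / a ^ N + \<beta> / b ^ N"
proof -
  define m where "m = \<alpha> * a + \<beta> * b"
  define c where "c = real N / m ^ Suc N"
  define t where "t x = 1 / m ^ N - c * (x - m)" for x
  have m: "m > 0"
    using assms by (simp add: m_def add_pos_pos)
  have \<alpha>: "\<alpha> = 1 - \<beta>"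
    using assms by simp
  have am: "a - m = \<beta> * (a - b)" and bm: "b - m = \<alpha> * (b - a)"
    unfolding m_def \<alpha> by (simp_all add: algebra_simps)
  have "a \<noteq> m" "b \<noteq> m"
    using am bm assms by auto
  then have ta: "t a < 1 / a ^ N" and tb: "t b < 1 / b ^ N"
    using inverse_power_gt_tangent[of a m N] inverse_power_gt_tangent[of b m N] assms m
    by (simp_all add: t_def c_def)
  have "1 / m ^ N = (\<alpha> + \<beta>) * (1 / m ^ N) - c * (\<alpha> * (a - m) + \<beta> * (b - m))"
    unfolding am bm using assms by (simp add: algebra_simps)
  also have "\<dots> = \<alpha> * t a + \<beta> * t b"
    unfolding t_def by (simp only: algebra_simps)
  also have "\<dots> < \<alpha> * (1 / a ^ N) + \<beta> * (1 / b ^ N)"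
    using assms ta tb by (intro add_strict_mono mult_strict_left_mono)
  finally show ?thesis by (simp add: m_def)
qed

text \<open>
  For \<open>d < 1\<close> the point \<open>y + 1\<close> is a convex combination of \<open>y + d\<close> and \<open>y + 1 + d\<close>; for \<open>d > 1\<close> it
  is \<open>y + d\<close> that lies between \<open>y + 1\<close> and \<open>y + 1 + d\<close>, which reverses the sign.
\<close>
lemma second_difference_sign:
  fixes d y :: real
  assumes d: "d > 0" "d \<noteq> 1" and y: "y > 0" and N: "N \<ge> 1"
  shows "sgn (1 - d) * (d / (y + d) ^ N - 1 / (y + 1) ^ N + (1 - d) / (y + 1 + d) ^ N) > 0"
proof (cases "d < 1")
  case True
  have "d * (y + d) + (1 - d) * (y + 1 + d) = y + 1"
    by (simp add: algebra_simps)
  with inverse_power_strict_Jensen[of "y + d" "y + 1 + d" d "1 - d" N] True assms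
  show ?thesis by simp
next
  case False
  with d have "d > 1" by simp
  have "1 / d * (y + 1) + (1 - 1 / d) * (y + 1 + d) = y + d"
    using d by (simp add: field_simps)
  with inverse_power_strict_Jensen[of "y + 1" "y + 1 + d" "1 / d" "1 - 1 / d" N] \<open>d > 1\<close> assms
  have "1 / (y + d) ^ N < 1 / d / (y + 1) ^ N + (1 - 1 / d) / (y + 1 + d) ^ N"
    by simp
  then have "d * (1 / (y + d) ^ N) < d * (1 / d / (y + 1) ^ N + (1 - 1 / d) / (y + 1 + d) ^ N)"
    using d by (intro mult_strict_left_mono) auto
  also have "\<dots> = 1 / (y + 1) ^ N + (d - 1) / (y + 1 + d) ^ N"
    using d by (simp add: distrib_left right_diff_distrib flip: times_divide_eq_right)
      (simp add: diff_divide_distrib algebra_simps)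
  finally show ?thesis
    using \<open>d > 1\<close> by (simp add: diff_divide_distrib)
qed

section \<open>Polygamma functions at infinity\<close>

lemma pos_not_nonpos_Ints:
  fixes x :: real
  assumes "x > 0"
  shows "x \<notin> \<int>\<^sub>\<le>\<^sub>0"
  using assms by (auto dest: nonpos_Ints_nonpos)

lemma Polygamma_MVT:
  fixes x d :: real
  assumes "x > 0" "d > 0"
  obtains \<xi> where "x < \<xi>" "\<xi> < x + d" "Polygamma n (x + d) - Polygamma n x = d * Polygamma (Suc n) \<xi>"
proof -
  have "\<exists>\<xi>>x. \<xi> < x + d \<and>
      Polygamma n (x + d) - Polygamma n x = (x + d - x) * Polygamma (Suc n) \<xi>"
    using assms
    by (intro MVT2) (auto intro!: has_field_derivative_Polygamma pos_not_nonpos_Ints)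
  then show ?thesis using that by auto
qed

lemma alternating_Polygamma_antimono:
  fixes x y :: real
  assumes "0 < x" "x \<le> y"
  shows "(-1) ^ n * Polygamma (Suc n) y \<le> (-1) ^ n * Polygamma (Suc n) x"
proof (cases "even n")
  case True
  then show ?thesis
    using Polygamma_real_strict_antimono[of x y "Suc n"] assms by (cases "x = y") auto
next
  case False
  then show ?thesis
    using Polygamma_real_mono[of x y "Suc n"] assms by auto
qed

text \<open>
  The unit increment of the \<open>n\<close>-th polygamma function is the explicit term of its recurrence and
  also a value of the next polygamma function at a point of the unit interval; monotonicity
  compares that value with those at the two endpoints.
\<close>
lemma alternating_Polygamma_bounds:
  fixes x :: real
  assumes "x > 0"
  shows "fact n / x ^ Suc n \<le> (-1) ^ n * Polygamma (Suc n) x"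
    and "(-1) ^ n * Polygamma (Suc n) (x + 1) \<le> fact n / x ^ Suc n"
proof -
  obtain \<xi> where \<xi>: "x < \<xi>" "\<xi> < x + 1"
    and eq: "Polygamma n (x + 1) - Polygamma n x = 1 * Polygamma (Suc n) \<xi>"
    using Polygamma_MVT[OF assms, of 1 n] by auto
  have "(-1) ^ n * Polygamma (Suc n) \<xi> = (-1) ^ n * ((-1) ^ n * fact n / x ^ Suc n)"
    using eq Polygamma_plus1[of x n] assms by simp
  also have "\<dots> = fact n / x ^ Suc n"
    by (simp flip: mult.assoc power_mult_distrib)
  finally have *: "(-1) ^ n * Polygamma (Suc n) \<xi> = fact n / x ^ Suc n" .
  show "fact n / x ^ Suc n \<le> (-1) ^ n * Polygamma (Suc n) x"
    using alternating_Polygamma_antimono[of x \<xi> n] \<xi> assms * by simp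
  show "(-1) ^ n * Polygamma (Suc n) (x + 1) \<le> fact n / x ^ Suc n"
    using alternating_Polygamma_antimono[of \<xi> "x + 1" n] \<xi> assms * by simp
qed

definition Polygamma_increment :: "real \<Rightarrow> nat \<Rightarrow> real \<Rightarrow> real" where
  "Polygamma_increment d n y = (-1) ^ n * (Polygamma n (y + d) - Polygamma n y)"

lemma Polygamma_increment_bounds:
  assumes "d > 0" "y > 1"
  shows "d * fact n / (y + d) ^ Suc n \<le> Polygamma_increment d n y"
    and "Polygamma_increment d n y \<le> d * fact n / (y - 1) ^ Suc n"
proof -
  obtain \<xi> where \<xi>: "y < \<xi>" "\<xi> < y + d"
    and eq: "Polygamma n (y + d) - Polygamma n y = d * Polygamma (Suc n) \<xi>"
    using Polygamma_MVT[of y d n] assms by auto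
  have inc: "Polygamma_increment d n y = d * ((-1) ^ n * Polygamma (Suc n) \<xi>)"
    by (simp add: Polygamma_increment_def eq)
  have "fact n / (y + d) ^ Suc n \<le> (-1) ^ n * Polygamma (Suc n) \<xi>"
    using alternating_Polygamma_bounds(1)[of "y + d" n]
      alternating_Polygamma_antimono[of \<xi> "y + d" n] \<xi> assms by simp
  from mult_left_mono[OF this, of d] assms
  show "d * fact n / (y + d) ^ Suc n \<le> Polygamma_increment d n y"
    by (simp add: inc)
  have "(-1) ^ n * Polygamma (Suc n) \<xi> \<le> fact n / (y - 1) ^ Suc n"
    using alternating_Polygamma_bounds(2)[of "y - 1" n]
      alternating_Polygamma_antimono[of y \<xi> n] \<xi> assms by simp
  from mult_left_mono[OF this, of d] assms
  show "Polygamma_increment d n y \<le> d * fact n / (y - 1) ^ Suc n"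
    by (simp add: inc)
qed

lemma filterlim_shift_at_top: "filterlim (\<lambda>y. y + s) at_top at_top" for s :: real
  using filterlim_tendsto_add_at_top[OF tendsto_const filterlim_ident, of s]
  by (simp add: add.commute)

lemma tendsto_const_over_shifted_power:
  fixes c s :: real
  assumes "N \<ge> 1"
  shows "((\<lambda>y. c / (y + s) ^ N) \<longlongrightarrow> 0) at_top"
  using assms
  by (intro tendsto_divide_0[OF tendsto_const] filterlim_at_top_imp_at_infinity
      filterlim_pow_at_top filterlim_shift_at_top) auto

lemma tendsto_mult_shifted_power:
  fixes c s :: real
  shows "((\<lambda>y. y * (c / (y + s) ^ Suc n)) \<longlongrightarrow> (if n = 0 then c else 0)) at_top"
proof -
  have "((\<lambda>y. c / (y + s) ^ n) \<longlongrightarrow> (if n = 0 then c else 0)) at_top"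
    using tendsto_const_over_shifted_power[of n c s] by (cases "n = 0") auto
  moreover have "((\<lambda>y. s * (c / (y + s) ^ Suc n)) \<longlongrightarrow> 0) at_top"
    by (intro tendsto_mult_right_zero tendsto_const_over_shifted_power) simp
  ultimately have "((\<lambda>y. c / (y + s) ^ n - s * (c / (y + s) ^ Suc n)) \<longlongrightarrow> (if n = 0 then c else 0) - 0) at_top"
    by (rule tendsto_diff)
  moreover have "\<forall>\<^sub>F y in at_top. c / (y + s) ^ n - s * (c / (y + s) ^ Suc n) = y * (c / (y + s) ^ Suc n)"
    using eventually_gt_at_top[of "- s"]
  proof eventually_elim
    case (elim y)
    then have "c / (y + s) ^ n = (y + s) * (c / (y + s) ^ Suc n)"
      by simp
    then show ?case
      by (simp only:) (simp only: algebra_simps)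
  qed
  ultimately show ?thesis
    by (auto intro: Lim_transform_eventually)
qed

lemma Polygamma_increment_tendsto_0:
  assumes "d > 0"
  shows "(Polygamma_increment d n \<longlongrightarrow> 0) at_top"
proof (rule tendsto_sandwich)
  show "\<forall>\<^sub>F y in at_top. d * fact n / (y + d) ^ Suc n \<le> Polygamma_increment d n y"
    using eventually_gt_at_top[of 1]
    by eventually_elim (use Polygamma_increment_bounds assms in auto)
  show "\<forall>\<^sub>F y in at_top. Polygamma_increment d n y \<le> d * fact n / (y + (- 1)) ^ Suc n"
    using eventually_gt_at_top[of 1]
    by eventually_elim (use Polygamma_increment_bounds assms in auto)
qed (rule tendsto_const_over_shifted_power; simp)+

lemma mult_Polygamma_increment_tendsto:
  assumes "d > 0"
  shows "((\<lambda>y. y * Polygamma_increment d n y) \<longlongrightarrow> (if n = 0 then d else 0)) at_top"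
proof (rule tendsto_sandwich)
  have lim: "((\<lambda>y. y * (d * fact n / (y + s) ^ Suc n)) \<longlongrightarrow> (if n = 0 then d else 0)) at_top" for s
    using tendsto_mult_shifted_power[of "d * fact n" s n] by (cases "n = 0") auto
  show "((\<lambda>y. y * (d * fact n / (y + d) ^ Suc n)) \<longlongrightarrow> (if n = 0 then d else 0)) at_top"
    and "((\<lambda>y. y * (d * fact n / (y + (-1)) ^ Suc n)) \<longlongrightarrow> (if n = 0 then d else 0)) at_top"
    by (rule lim)+
  show "\<forall>\<^sub>F y in at_top. y * (d * fact n / (y + d) ^ Suc n) \<le> y * Polygamma_increment d n y"
    using eventually_gt_at_top[of 1]
    by eventually_elim (rule mult_left_mono, use Polygamma_increment_bounds assms in auto)
  show "\<forall>\<^sub>F y in at_top. y * Polygamma_increment d n y \<le> y * (d * fact n / (y + (- 1)) ^ Suc n)"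
    using eventually_gt_at_top[of 1]
    by eventually_elim (rule mult_left_mono, use Polygamma_increment_bounds assms in auto)
qed

section \<open>The function \<open>y H\<^sub>d(y)\<close> and its differences\<close>

text \<open>
  \<open>G d n\<close> is \<open>(-1)\<^sup>n\<close> times the \<open>n\<close>-th derivative of \<open>y H\<^sub>d(y)\<close>. In the case \<open>n = 0\<close> the truncated
  index \<open>n - 1\<close> is harmless because of the factor \<open>real n\<close>.
\<close>
definition G :: "real \<Rightarrow> nat \<Rightarrow> real \<Rightarrow> real" where
  "G d n y = y * Polygamma_increment d n y - real n * Polygamma_increment d (n - 1) y
     - (if n = 0 then d else 0)"

lemma Polygamma_increment_has_derivative:
  assumes "d > 0" "y > 0"
  shows "(Polygamma_increment d n has_real_derivative - Polygamma_increment d (Suc n) y) (at y)"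
proof -
  have "((\<lambda>x. x + d) has_real_derivative 1) (at y)"
    by (auto intro!: derivative_eq_intros)
  from DERIV_chain2[OF has_field_derivative_Polygamma this]
  have "((\<lambda>x. Polygamma n (x + d)) has_real_derivative Polygamma (Suc n) (y + d)) (at y)"
    using assms by (simp add: pos_not_nonpos_Ints)
  from DERIV_diff[OF this has_field_derivative_Polygamma[of y n]]
  have "((\<lambda>x. Polygamma n (x + d) - Polygamma n x) has_real_derivative
      Polygamma (Suc n) (y + d) - Polygamma (Suc n) y) (at y)"
    using assms by (simp add: pos_not_nonpos_Ints)
  from DERIV_cmult[OF this, of "(-1) ^ n"] show ?thesis
    unfolding Polygamma_increment_def[abs_def] by simp
qed

lemma G_0: "y > 0 \<Longrightarrow> G d 0 y = y * H d y"
  by (simp add: G_def Polygamma_increment_def H_def algebra_simps)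

lemma G_has_derivative:
  assumes "d > 0" "y > 0"
  shows "(G d n has_real_derivative - G d (Suc n) y) (at y)"
proof -
  note D = Polygamma_increment_has_derivative[OF assms]
  have "((\<lambda>y. y * Polygamma_increment d n y - real n * Polygamma_increment d (n - 1) y
      - (if n = 0 then d else 0)) has_real_derivative
      1 * Polygamma_increment d n y + - Polygamma_increment d (Suc n) y * y
      - real n * - Polygamma_increment d (Suc (n - 1)) y - 0) (at y)"
    by (intro DERIV_diff DERIV_mult DERIV_cmult DERIV_const DERIV_ident D)
  also have "1 * Polygamma_increment d n y + - Polygamma_increment d (Suc n) y * y
      - real n * - Polygamma_increment d (Suc (n - 1)) y - 0 = - G d (Suc n) y"
    by (cases n) (simp_all add: G_def algebra_simps)
  finally show ?thesis unfolding G_def[abs_def] .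
qed

lemma alternating_derivatives_G:
  assumes "d > 0"
  shows "alternating_derivatives (\<lambda>n y. c * G d n y) (\<lambda>y. c * G d 0 y)"
  using DERIV_cmult[OF G_has_derivative[OF assms], of _ c]
  by (simp add: alternating_derivatives_def)

lemma Polygamma_increment_plus1:
  assumes "d > 0" "y > 0"
  shows "Polygamma_increment d n (y + 1) =
         Polygamma_increment d n y - fact n * (1 / y ^ Suc n - 1 / (y + d) ^ Suc n)"
proof -
  have "Polygamma n (y + 1 + d) = Polygamma n (y + d) + (-1) ^ n * fact n / (y + d) ^ Suc n"
    using Polygamma_plus1[of "y + d" n] assms by (simp add: add_ac)
  moreover have "Polygamma n (y + 1) = Polygamma n y + (-1) ^ n * fact n / y ^ Suc n"
    using Polygamma_plus1[of y n] assms by simp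
  moreover have "(-1) ^ n * ((-1) ^ n * fact n * u) = fact n * u" for u :: real
    by (simp flip: mult.assoc power_mult_distrib)
  ultimately show ?thesis
    unfolding Polygamma_increment_def
    by (simp add: algebra_simps divide_inverse del: power_Suc)
qed

lemma G_difference:
  assumes "d > 0" "y > 0"
  shows "G d n y - G d n (y + 1) = fact n * (1 / y ^ Suc n + (d - 1) / (y + d) ^ Suc n)
     - Polygamma_increment d n y"
proof (cases n)
  case 0
  have "(y + 1) * (1 / y - 1 / (y + d)) = 1 / y + (d - 1) / (y + d)"
    using assms by (simp add: field_simps)
  then show ?thesis
    using 0 Polygamma_increment_plus1[OF assms, of 0]
    by (simp add: G_def right_diff_distrib distrib_right)
next
  case (Suc m)
  define p q where "p = 1 / y ^ Suc n" and "q = 1 / (y + d) ^ Suc n"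
  have f: "fact n = real n * fact m" and "n \<noteq> 0"
    using Suc by simp_all
  have inc_n: "Polygamma_increment d n (y + 1) = Polygamma_increment d n y - fact n * (p - q)"
    unfolding p_def q_def by (rule Polygamma_increment_plus1[OF assms])
  have "1 / y ^ Suc m = y * p" "1 / (y + d) ^ Suc m = (y + d) * q"
    using assms Suc by (simp_all add: p_def q_def)
  then have inc_m: "Polygamma_increment d (n - 1) (y + 1) =
      Polygamma_increment d (n - 1) y - fact m * (y * p - (y + d) * q)"
    using Polygamma_increment_plus1[OF assms, of m] Suc by simp
  have "G d n y - G d n (y + 1) = (y + 1) * (fact n * (p - q))
      - real n * (fact m * (y * p - (y + d) * q)) - Polygamma_increment d n y"
    unfolding G_def inc_n inc_m using \<open>n \<noteq> 0\<close> by (simp add: algebra_simps)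
  also have "\<dots> = fact n * (p + (d - 1) * q) - Polygamma_increment d n y"
    unfolding f by (simp add: algebra_simps)
  finally show ?thesis by (simp add: p_def q_def)
qed

lemma G_second_difference:
  assumes "d > 0" "y > 0"
  shows "(G d n y - G d n (y + 1)) - (G d n (y + 1) - G d n (y + 1 + 1)) =
    fact n * (d / (y + d) ^ Suc n - 1 / (y + 1) ^ Suc n + (1 - d) / (y + 1 + d) ^ Suc n)"
proof -
  have 1: "y + 1 > 0" using assms by simp
  show ?thesis
    unfolding G_difference[OF assms] G_difference[OF assms(1) 1] Polygamma_increment_plus1[OF assms]
    by (simp add: algebra_simps diff_divide_distrib del: power_Suc)
qed

lemma G_tendsto_0:
  assumes "d > 0"
  shows "(G d n \<longlongrightarrow> 0) at_top"
proof -
  have "(G d n \<longlongrightarrow> (if n = 0 then d else 0) - real n * 0 - (if n = 0 then d else 0)) at_top"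
    unfolding G_def[abs_def]
    by (intro tendsto_diff tendsto_const tendsto_mult_left mult_Polygamma_increment_tendsto
        Polygamma_increment_tendsto_0 assms)
  then show ?thesis by simp
qed

lemma G_difference_tendsto_0:
  assumes "d > 0"
  shows "((\<lambda>y. G d n y - G d n (y + 1)) \<longlongrightarrow> 0) at_top"
  using tendsto_diff[OF G_tendsto_0[OF assms] filterlim_compose[OF G_tendsto_0[OF assms] filterlim_shift_at_top]]
  by simp

text \<open>Along \<open>y, y + 1, y + 2, \<dots>\<close> the function decreases strictly to its limit \<open>0\<close>.\<close>
lemma pos_if_unit_steps_decrease:
  fixes f :: "real \<Rightarrow> real"
  assumes step: "\<And>y. y > 0 \<Longrightarrow> f (y + 1) < f y" and lim: "(f \<longlongrightarrow> 0) at_top" and y: "y > 0"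
  shows "f y > 0"
proof -
  have "decseq (\<lambda>j. f (y + 1 + real j))"
    using y step[of "y + 1 + real j" for j]
    by (intro decseq_SucI) (auto simp: add_ac intro: less_imp_le)
  moreover have "(\<lambda>j. f (y + 1 + real j)) \<longlonglongrightarrow> 0"
    by (intro filterlim_compose[OF lim] filterlim_tendsto_add_at_top[OF tendsto_const]
        filterlim_real_sequentially)
  ultimately have "0 \<le> f (y + 1 + real 0)"
    by (rule decseq_ge)
  with step[OF y] show ?thesis by simp
qed

lemma signed_G_pos:
  assumes d: "d > 0" "d \<noteq> 1" and y: "y > 0"
  shows "sgn (1 - d) * G d n y > 0"
proof -
  let ?s = "sgn (1 - d)"
  have diff_pos: "?s * (G d n y - G d n (y + 1)) > 0" if "y > 0" for y
  proof (rule pos_if_unit_steps_decrease[OF _ _ that])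
    fix y :: real
    assume y: "y > 0"
    have "0 < fact n * (?s * (d / (y + d) ^ Suc n - 1 / (y + 1) ^ Suc n + (1 - d) / (y + 1 + d) ^ Suc n))"
      using second_difference_sign[OF d y, of "Suc n"]
      by (intro mult_pos_pos[OF fact_gt_zero]) simp
    also have "\<dots> = ?s * (G d n y - G d n (y + 1)) - ?s * (G d n (y + 1) - G d n (y + 1 + 1))"
      unfolding right_diff_distrib[symmetric] G_second_difference[OF d(1) y] by (rule mult.left_commute)
    finally show "?s * (G d n (y + 1) - G d n (y + 1 + 1)) < ?s * (G d n y - G d n (y + 1))"
      by simp
  next
    show "((\<lambda>y. ?s * (G d n y - G d n (y + 1))) \<longlongrightarrow> 0) at_top"
      by (rule tendsto_mult_right_zero[OF G_difference_tendsto_0[OF d(1)]])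
  qed
  show ?thesis
  proof (rule pos_if_unit_steps_decrease[OF _ _ y])
    show "?s * G d n (y + 1) < ?s * G d n y" if "y > 0" for y
      using diff_pos[OF that] by (simp add: right_diff_distrib)
    show "((\<lambda>y. ?s * G d n y) \<longlongrightarrow> 0) at_top"
      by (rule tendsto_mult_right_zero[OF G_tendsto_0[OF d(1)]])
  qed
qed

section \<open>Which exponents are admissible\<close>

text \<open>The recurrence of \<open>\<psi>\<close> splits off the pole of \<open>\<psi>\<close> at \<open>0\<close>, which \<open>y\<close> cancels.\<close>
lemma G_0_tendsto_at_0:
  assumes "d > 0"
  shows "(G d 0 \<longlongrightarrow> 1 - d) (at_right 0)"
proof -
  have "((\<lambda>y. y * (Digamma (y + d) - Digamma (y + 1)) + 1 - d) \<longlongrightarrow>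
      0 * (Digamma (0 + d) - Digamma (0 + 1)) + 1 - d) (at_right 0)"
    using assms by (intro tendsto_intros pos_not_nonpos_Ints) auto
  then have "((\<lambda>y. y * (Digamma (y + d) - Digamma (y + 1)) + 1 - d) \<longlongrightarrow> 1 - d) (at_right 0)"
    by simp
  moreover have "\<forall>\<^sub>F y in at_right 0. y * (Digamma (y + d) - Digamma (y + 1)) + 1 - d = G d 0 y"
    using eventually_at_right_less[of 0]
    by eventually_elim (simp add: G_def Polygamma_increment_def Digamma_plus1 field_simps)
  ultimately show ?thesis
    by (rule Lim_transform_eventually)
qed

lemma powr_mult_H_sharp:
  assumes "y > 0"
  shows "y powr a * H_sharp d y = y powr (- (1 - a)) * (sgn (1 - d) * G d 0 y)"
proof -
  have "y powr (- (1 - a)) = y powr a / y"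
    using assms by (simp add: powr_diff)
  then show ?thesis
    using assms by (simp add: G_0 H_sharp_def)
qed

lemma strictly_completely_monotone_powr_H_sharp:
  assumes d: "d > 0" "d \<noteq> 1" and "a \<le> 1"
  shows "strictly_completely_monotone (\<lambda>y. y powr a * H_sharp d y)"
proof (rule strictly_completely_monotone_mult[OF alternating_derivatives_powr[of "1 - a"]
      alternating_derivatives_G[OF d(1), of "sgn (1 - d)"]])
  fix n and y :: real
  assume y: "y > 0"
  show "pochhammer (1 - a) 0 * y powr (- (1 - a) - real 0) > 0"
    using y by simp
  show "pochhammer (1 - a) n * y powr (- (1 - a) - real n) \<ge> 0"
    using \<open>a \<le> 1\<close> by (auto simp: pochhammer_prod intro!: mult_nonneg_nonneg prod_nonneg)
  show "sgn (1 - d) * G d n y > 0"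
    by (rule signed_G_pos[OF d y])
qed (rule powr_mult_H_sharp)

lemma tendsto_0_not_strictly_completely_monotone:
  assumes "(f \<longlongrightarrow> 0) (at_right 0)"
  shows "\<not> strictly_completely_monotone f"
proof
  assume f: "strictly_completely_monotone f"
  have pos: "f y > 0" if "y > 0" for y
    using f that unfolding strictly_completely_monotone_def by (metis funpow_0 mult_1 power_0)
  have der: "DERIV f y :> deriv f y" "deriv f y < 0" if "y > 0" for y
  proof -
    have "f differentiable at y"
      using f that unfolding strictly_completely_monotone_def by (metis funpow_0)
    then show "DERIV f y :> deriv f y"
      by (simp add: DERIV_deriv_iff_real_differentiable)
    have "(-1) ^ 1 * (deriv ^^ 1) f y > 0"
      using f that unfolding strictly_completely_monotone_def by blast
    then show "deriv f y < 0" by simp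
  qed
  have "f 1 \<le> f y" if "0 < y" "y < 1" for y
    using DERIV_neg_imp_decreasing[of y 1 f] der that
    by (metis less_eq_real_def less_le_trans)
  then have "\<forall>\<^sub>F y in at_right 0. f 1 \<le> f y"
    by (auto simp: eventually_at_right_field intro!: exI[of _ 1])
  then have "f 1 \<le> 0"
    using tendsto_lowerbound[OF assms] by simp
  with pos[of 1] show False by simp
qed

lemma powr_H_sharp_tendsto_0:
  assumes "d > 0" "a > 1"
  shows "((\<lambda>y. y powr a * H_sharp d y) \<longlongrightarrow> 0) (at_right 0)"
proof -
  have "((\<lambda>y. y powr (- (1 - a))) \<longlongrightarrow> 0) (at_right (0 :: real))"
    using assms
    by (intro tendsto_zero_powrI[where b = "- (1 - a)"])
      (auto intro: tendsto_ident_at eventually_at_right_less eventually_mono simp: less_imp_le)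
  from tendsto_mult[OF this tendsto_mult_left[OF G_0_tendsto_at_0[OF assms(1)], of "sgn (1 - d)"]]
  have "((\<lambda>y. y powr (- (1 - a)) * (sgn (1 - d) * G d 0 y)) \<longlongrightarrow> 0) (at_right 0)"
    by simp
  moreover have "\<forall>\<^sub>F y in at_right 0.
      y powr (- (1 - a)) * (sgn (1 - d) * G d 0 y) = y powr a * H_sharp d y"
    using eventually_at_right_less[of 0] by eventually_elim (simp only: powr_mult_H_sharp)
  ultimately show ?thesis
    by (rule Lim_transform_eventually)
qed

theorem theorem3p8:
  fixes d :: real
  assumes "d \<in> {0<..<1} \<union> {1<..}"
  shows "(\<forall>y>0. H_sharp d y > 0) \<and>
         (\<forall>a::real. strictly_completely_monotone (\<lambda>y. y powr a * H_sharp d y) \<longleftrightarrow> a \<le> 1)"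
proof (intro conjI allI impI)
  have d: "d > 0" "d \<noteq> 1"
    using assms by auto
  show "H_sharp d y > 0" if "y > 0" for y
    using signed_G_pos[OF d that, of 0] that
    by (simp add: H_sharp_def G_0 mult.left_commute zero_less_mult_iff)
  show "strictly_completely_monotone (\<lambda>y. y powr a * H_sharp d y) \<longleftrightarrow> a \<le> 1" for a
    using strictly_completely_monotone_powr_H_sharp[OF d]
      tendsto_0_not_strictly_completely_monotone[OF powr_H_sharp_tendsto_0[OF d(1)]]
    by (meson not_le)
qed

end
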